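(* For every integer $k \geq 3$, we have $\pi(K_{k+1}^{(k)}) < \pi(K_{k+2}^{(k)-})$.
   Context: A $k$-uniform hypergraph ($k$-graph) $H=(V,E)$ has vertex set $V$ and edge set $E\subseteq \binom{V}{k}$. For $k$-graphs $F,H$, $H$ is $F$-free if $H$ contains no copy of $F$. The Turán number $\mathrm{ex}(n,F)$ is the maximum number of edges of an $F$-free $k$-graph on $n$ vertices, and the Turán density is $\pi(F)=\lim_{n\to\infty}\mathrm{ex}(n,F)/\binom{n}{k}$. $K_{\ell}^{(k)}$ denotes the complete $k$-graph on $\ell$ vertices, and $K_{\ell}^{(k)-}$ denotes $K_{\ell}^{(k)}$ with one edge removed. *)

theory Defs
  imports Complex_Main "HOL-Library.Ramsey"
begin

type_synonym 'a hypergraph = "'a set \<times> 'a set set"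

abbreviation verts :: "'a hypergraph \<Rightarrow> 'a set" where
  "verts H \<equiv> fst H"

abbreviation edges :: "'a hypergraph \<Rightarrow> 'a set set" where
  "edges H \<equiv> snd H"

definition uniform_hypergraph :: "nat \<Rightarrow> 'a hypergraph \<Rightarrow> bool" where
  "uniform_hypergraph k H \<longleftrightarrow> finite (verts H) \<and> edges H \<subseteq> nsets (verts H) k"

text \<open>Copies are not required to be induced.\<close>

definition contains_copy :: "'a hypergraph \<Rightarrow> 'b hypergraph \<Rightarrow> bool" where
  "contains_copy H F \<longleftrightarrow>
     (\<exists>f. inj_on f (verts F) \<and> f ` verts F \<subseteq> verts H \<and> (\<forall>e\<in>edges F. f ` e \<in> edges H))"

definition hypergraph_free :: "'b hypergraph \<Rightarrow> 'a hypergraph \<Rightarrow> bool" where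
  "hypergraph_free F H \<longleftrightarrow> \<not> contains_copy H F"

text \<open>
  Every finite hypergraph is isomorphic to one whose vertices are natural numbers, so the
  maximum ranges over these only. The edge counts are bounded by \<open>n choose k\<close>, and some
  \<open>F\<close>-free hypergraph exists as soon as \<open>F\<close> has an edge.
\<close>

definition turan_number :: "nat \<Rightarrow> nat \<Rightarrow> 'b hypergraph \<Rightarrow> nat" where
  "turan_number k n F =
     Max {card (edges H) | H :: nat hypergraph.
            uniform_hypergraph k H \<and> card (verts H) = n \<and> hypergraph_free F H}"

definition turan_density :: "nat \<Rightarrow> 'b hypergraph \<Rightarrow> real" where
  "turan_density k F = lim (\<lambda>n. real (turan_number k n F) / real (n choose k))"

definition complete_hypergraph :: "nat \<Rightarrow> nat \<Rightarrow> nat hypergraph" where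
  "complete_hypergraph k l = ({..<l}, nsets {..<l} k)"

text \<open>
  All choices of the removed edge give isomorphic hypergraphs; here it is \<open>{..<k}\<close>, which is
  an edge of the complete hypergraph precisely when \<open>k \<le> l\<close>.
\<close>

definition complete_hypergraph_minus :: "nat \<Rightarrow> nat \<Rightarrow> nat hypergraph" where
  "complete_hypergraph_minus k l = ({..<l}, nsets {..<l} k - {{..<k}})"

end

theory Submission
  imports Defs "HOL-Library.FuncSet"
begin

text \<open>
  Removing any single edge from \<open>K\<^bsub>k+2\<^esub>\<close> minus an edge still leaves a copy of \<open>K\<^bsub>k+1\<^esub>\<close>,
  so an extremal \<open>K\<^bsub>k+1\<^esub>\<close>-free hypergraph \<open>H\<close> can be enriched a little; the point is to gain
  a positive proportion of edges.

  For \<open>k \<ge> 4\<close>, blow up every vertex of \<open>H\<close> into \<open>M\<close> copies and let \<open>A\<^sub>0, A\<^sub>1, A\<^sub>2\<close> be the first three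
  layers. Add all \<open>k\<close>-sets meeting each \<open>A\<^sub>i\<close> exactly once, and delete the other edges having at least four
  vertices in \<open>A\<^sub>0 \<union> A\<^sub>1 \<union> A\<^sub>2\<close>. In a copy of \<open>K\<^bsub>k+2\<^esub>\<close> minus an edge some vertex \<open>g\<close> of the
  missing edge is the only vertex of the copy in some \<open>A\<^sub>i\<close> (or some \<open>A\<^sub>i\<close> is not met at all), so deleting \<open>g\<close>
  leaves a \<open>K\<^bsub>k+1\<^esub>\<close> without new edges, which projects to one in \<open>H\<close>. The gain has order
  \<open>M\<^sup>-\<^sup>3\<close> and the loss order \<open>M\<^sup>-\<^sup>4\<close>.

  For \<open>k = 3\<close>, add instead new vertices whose link is a complete tripartite graph, of density
  \<open>2/3\<close>; this wins because \<open>\<pi>(K\<^sub>4) \<le> 29/45 < 2/3\<close>.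
\<close>

section \<open>Turan numbers and densities\<close>

definition map_hypergraph :: "('a \<Rightarrow> 'b) \<Rightarrow> 'a hypergraph \<Rightarrow> 'b hypergraph" where
  "map_hypergraph f H = (f ` verts H, image f ` edges H)"

lemma card_nsets: "finite A \<Longrightarrow> card (nsets A k) = card A choose k"
  unfolding nsets_def by (metis (no_types, lifting) Collect_cong finite_subset n_subsets)

text \<open>If \<open>X\<close> lies inside \<open>e0\<close> it is a proper subset, so a point of
  \<open>W\<close> outside \<open>e0\<close> still fits; every \<open>k\<close>-set above the result
  differs from \<open>e0\<close>. This places pairs and 4-sets of a copy inside an edge that is
  really present.\<close>

lemma nsets_minus_one_cover:
  assumes "X \<subseteq> W" "finite W" "card X \<le> k" "k < card W" "e0 \<in> nsets W k" "X \<noteq> e0"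
  shows "\<exists>S \<in> nsets W k. S \<noteq> e0 \<and> X \<subseteq> S"
proof -
  have e0: "e0 \<subseteq> W" "finite e0" "card e0 = k" using assms(5) by (auto simp: nsets_def)
  have fin: "finite X" using assms(1,2) by (rule finite_subset)
  have "\<exists>Y. X \<subseteq> Y \<and> Y \<subseteq> W \<and> card Y \<le> k \<and> \<not> Y \<subseteq> e0"
  proof (cases "X \<subseteq> e0")
    case True
    then have "card X < k" using assms(6) e0 by (metis psubsetI psubset_card_mono)
    moreover obtain w where "w \<in> W" "w \<notin> e0"
      using e0 assms(4) by (metis less_irrefl subsetI subset_antisym)
    ultimately show ?thesis
      using assms(1) fin by (intro exI[of _ "insert w X"]) (auto simp: card_insert_if)
  qed (use assms in blast)
  then obtain Y where Y: "X \<subseteq> Y" "Y \<subseteq> W" "card Y \<le> k" "\<not> Y \<subseteq> e0" by blast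
  obtain S where "Y \<subseteq> S" "S \<subseteq> W" "card S = k"
    using exists_subset_between[OF Y(3) _ Y(2) assms(2)] assms(4) by auto
  then show ?thesis
    using Y assms(2) by (intro bexI[of _ S]) (auto simp: nsets_def finite_subset)
qed

lemma uniform_edges_finite: "uniform_hypergraph k H \<Longrightarrow> finite (edges H)"
  unfolding uniform_hypergraph_def by (metis finite_imp_finite_nsets finite_subset)

lemma uniform_edges_Pow: "uniform_hypergraph k H \<Longrightarrow> edges H \<subseteq> Pow (verts H)"
  unfolding uniform_hypergraph_def nsets_def by blast

lemma uniform_card_edges_le:
  "uniform_hypergraph k H \<Longrightarrow> card (edges H) \<le> card (verts H) choose k"
  unfolding uniform_hypergraph_def by (metis card_mono card_nsets finite_imp_finite_nsets)

lemma uniform_map_hypergraph: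
  assumes "uniform_hypergraph k H" "inj_on f (verts H)"
  shows "uniform_hypergraph k (map_hypergraph f H)"
  unfolding uniform_hypergraph_def map_hypergraph_def fst_conv snd_conv
proof (intro conjI image_subsetI)
  show "finite (f ` verts H)" using assms by (simp add: uniform_hypergraph_def)
  fix e assume "e \<in> edges H"
  then have "e \<subseteq> verts H" "finite e" "card e = k"
    using assms(1) by (auto simp: uniform_hypergraph_def nsets_def)
  then show "f ` e \<in> nsets (f ` verts H) k"
    using assms(2) by (auto simp: nsets_def card_image inj_on_subset)
qed

lemma card_edges_map_hypergraph:
  assumes "uniform_hypergraph k H" "inj_on f (verts H)"
  shows "card (edges (map_hypergraph f H)) = card (edges H)"
  using inj_on_image_Pow[OF assms(2)] uniform_edges_Pow[OF assms(1)]
  by (simp add: map_hypergraph_def card_image inj_on_subset)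

lemma hypergraph_free_map:
  assumes "uniform_hypergraph k H" "inj_on f (verts H)" "hypergraph_free F H"
  shows "hypergraph_free F (map_hypergraph f H)"
proof -
  have False if copy: "contains_copy (map_hypergraph f H) F"
  proof -
    have "\<exists>g. inj_on g (verts F) \<and> g ` verts F \<subseteq> f ` verts H \<and> (\<forall>e\<in>edges F. g ` e \<in> image f ` edges H)"
      using copy unfolding contains_copy_def map_hypergraph_def fst_conv snd_conv .
    then obtain g where g: "inj_on g (verts F)" "g ` verts F \<subseteq> f ` verts H"
        and ge: "\<forall>e\<in>edges F. g ` e \<in> image f ` edges H" by metis
    let ?h = "inv_into (verts H) f \<circ> g"
    have "inj_on ?h (verts F)"
      using g by (intro comp_inj_on inj_on_inv_into)
    moreover have "?h ` verts F \<subseteq> verts H"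
    proof (intro image_subsetI)
      fix v assume "v \<in> verts F"
      then have "g v \<in> f ` verts H" by (intro subsetD[OF g(2)] imageI)
      then show "?h v \<in> verts H" unfolding comp_apply by (rule inv_into_into)
    qed
    moreover have "?h ` e \<in> edges H" if e: "e \<in> edges F" for e
    proof -
      obtain e' where e': "e' \<in> edges H" "g ` e = f ` e'"
        using bspec[OF ge e] by auto
      have "inv_into (verts H) f ` f ` e' = e'"
        using e'(1) uniform_edges_Pow[OF assms(1)] assms(2)
        by (intro inv_into_image_cancel) auto
      then show ?thesis using e' by (simp only: image_comp[symmetric])
    qed
    ultimately have "contains_copy H F"
      unfolding contains_copy_def by (intro exI[of _ ?h]) simp
    then show False using assms(3) by (simp add: hypergraph_free_def)
  qed
  then show ?thesis unfolding hypergraph_free_def by (rule notI)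
qed

lemma hypergraph_free_mono:
  assumes "hypergraph_free F H" "verts G \<subseteq> verts H" "edges G \<subseteq> edges H"
  shows "hypergraph_free F G"
  using assms unfolding hypergraph_free_def contains_copy_def
  by (meson order_trans subsetD)

text \<open>Finiteness makes the \<open>Max\<close> in \<open>turan_number\<close> a genuine
  maximum.\<close>

lemma finite_turan_set:
  "finite {card (edges H) | H :: nat hypergraph.
     uniform_hypergraph k H \<and> card (verts H) = n \<and> hypergraph_free F H}"
  by (rule finite_subset[of _ "{..n choose k}"]) (auto dest: uniform_card_edges_le)

text \<open>The vertex type is arbitrary because the blow-up below has pairs as vertices; a finite
  vertex set can be relabelled by natural numbers.\<close>

lemma card_edges_le_turan_number:
  fixes H :: "'a hypergraph"
  assumes "uniform_hypergraph k H" "hypergraph_free F H"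
  shows "card (edges H) \<le> turan_number k (card (verts H)) F"
proof -
  obtain f :: "'a \<Rightarrow> nat" where f: "inj_on f (verts H)"
    using assms(1) by (meson finite_imp_inj_to_nat_seg uniform_hypergraph_def)
  let ?G = "map_hypergraph f H"
  have "card (verts ?G) = card (verts H)"
    using f by (simp add: map_hypergraph_def card_image)
  then have "card (edges ?G) \<le> turan_number k (card (verts H)) F"
    unfolding turan_number_def
    using uniform_map_hypergraph[OF assms(1) f] hypergraph_free_map[OF assms(1) f assms(2)]
    by (intro Max_ge[OF finite_turan_set]) blast
  then show ?thesis using card_edges_map_hypergraph[OF assms(1) f] by simp
qed

text \<open>The edgeless hypergraph is \<open>F\<close>-free once \<open>F\<close> has an edge, so
  the maximum is taken over a nonempty set. A bijection then moves the vertices to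
  \<open>{..<n}\<close>.\<close>

lemma turan_number_attained:
  assumes "edges F \<noteq> {}"
  obtains H :: "nat hypergraph" where "uniform_hypergraph k H" "verts H = {..<n}"
    "hypergraph_free F H" "card (edges H) = turan_number k n F"
proof -
  let ?S = "{card (edges H) | H :: nat hypergraph.
     uniform_hypergraph k H \<and> card (verts H) = n \<and> hypergraph_free F H}"
  have "uniform_hypergraph k ({..<n}, {})" "hypergraph_free F ({..<n}, {})"
    using assms by (auto simp: uniform_hypergraph_def hypergraph_free_def contains_copy_def)
  then have "card (edges ({..<n}, {}::nat set set)) \<in> ?S" by fastforce
  then have "Max ?S \<in> ?S" by (intro Max_in[OF finite_turan_set]) blast
  then obtain H :: "nat hypergraph" where H: "uniform_hypergraph k H" "card (verts H) = n"
      "hypergraph_free F H" "card (edges H) = turan_number k n F"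
    unfolding turan_number_def by auto
  obtain f where f: "bij_betw f (verts H) {..<n}"
    using H(1,2) by (metis bij_betw_iff_card card_lessThan finite_lessThan uniform_hypergraph_def)
  then have "inj_on f (verts H)" "verts (map_hypergraph f H) = {..<n}"
    by (auto simp: bij_betw_def map_hypergraph_def)
  with H show thesis
    by (intro that[of "map_hypergraph f H"])
       (simp_all add: uniform_map_hypergraph hypergraph_free_map card_edges_map_hypergraph)
qed

section \<open>Averaging over vertex deletions and existence of the limit\<close>

text \<open>Delete each vertex of an extremal hypergraph in turn: every edge survives exactly
  \<open>Suc n - k\<close> deletions, and each remainder is \<open>F\<close>-free on
  \<open>n\<close> vertices.\<close>

lemma turan_number_Suc:
  assumes "edges F \<noteq> {}"
  shows "(Suc n - k) * turan_number k (Suc n) F \<le> Suc n * turan_number k n F"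
proof -
  obtain H :: "nat hypergraph" where H: "uniform_hypergraph k H" "verts H = {..<Suc n}"
    "hypergraph_free F H" "card (edges H) = turan_number k (Suc n) F"
    using turan_number_attained[OF assms] .
  have edge: "e \<subseteq> {..<Suc n} \<and> finite e \<and> card e = k" if "e \<in> edges H" for e
    using H(1,2) that by (auto simp: uniform_hypergraph_def nsets_def)
  have "card {v \<in> verts H. v \<notin> e} = Suc n - k" if "e \<in> edges H" for e
  proof -
    have "{v \<in> verts H. v \<notin> e} = {..<Suc n} - e" using H(2) by auto
    then show ?thesis using edge[OF that] by (simp add: card_Diff_subset)
  qed
  then have "(\<Sum>v\<in>verts H. card {e \<in> edges H. v \<notin> e}) = (Suc n - k) * card (edges H)"
    using H(2) uniform_edges_finite[OF H(1)] by (intro sum_multicount) auto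
  moreover have "card {e \<in> edges H. v \<notin> e} \<le> turan_number k n F" if "v \<in> verts H" for v
  proof -
    let ?G = "(verts H - {v}, {e \<in> edges H. v \<notin> e})"
    have "uniform_hypergraph k ?G"
      using H(1) by (auto simp: uniform_hypergraph_def nsets_def)
    moreover have "hypergraph_free F ?G"
      using H(3) by (rule hypergraph_free_mono) auto
    moreover have "card (verts ?G) = n" using that H(2) by simp
    ultimately show ?thesis using card_edges_le_turan_number[of k ?G F] by simp
  qed
  then have "(\<Sum>v\<in>verts H. card {e \<in> edges H. v \<notin> e}) \<le> card (verts H) * turan_number k n F"
    using sum_bounded_above[of "verts H" _ "turan_number k n F"] by simp
  ultimately show ?thesis using H(2,4) by simp
qed

abbreviation turan_ratio :: "nat \<Rightarrow> 'b hypergraph \<Rightarrow> nat \<Rightarrow> real" where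
  "turan_ratio k F n \<equiv> real (turan_number k n F) / real (n choose k)"

text \<open>The averaging bound combines with the absorption identity for binomials. The condition
  \<open>k \<le> n\<close> matters: below \<open>k\<close> the ratio is a division by zero, hence 0,
  and may jump up at \<open>k\<close>.\<close>

lemma turan_ratio_Suc_le:
  assumes "edges F \<noteq> {}" "k \<le> n"
  shows "turan_ratio k F (Suc n) \<le> turan_ratio k F n"
proof -
  let ?s = "turan_number k (Suc n) F" and ?t = "turan_number k n F"
  have pos: "0 < Suc n choose k" "0 < n choose k"
    using assms(2) by (auto simp: zero_less_binomial)
  have "(Suc n - k) * (Suc n choose k) = Suc n * (n choose k)"
    using binomial_absorb_comp[of "Suc n" k] by simp
  then have "Suc n * (?s * (n choose k)) = ((Suc n - k) * ?s) * (Suc n choose k)"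
    by (metis mult.left_commute mult.commute)
  also have "\<dots> \<le> (Suc n * ?t) * (Suc n choose k)"
    using turan_number_Suc[OF assms(1)] by (rule mult_right_mono) simp
  finally have "?s * (n choose k) \<le> ?t * (Suc n choose k)"
    unfolding mult.assoc Suc_mult_le_cancel1 .
  then have "real ?s * real (n choose k) \<le> real ?t * real (Suc n choose k)"
    by (simp only: of_nat_le_iff flip: of_nat_mult)
  moreover have "0 < real (Suc n choose k)" "0 < real (n choose k)"
    using pos by (simp_all only: of_nat_0_less_iff)
  ultimately show ?thesis by (simp only: divide_le_eq le_divide_eq times_divide_eq_left if_True)
qed

lemma turan_ratio_antimono:
  assumes "edges F \<noteq> {}" "k \<le> m" "m \<le> n"
  shows "turan_ratio k F n \<le> turan_ratio k F m"
  using assms(3)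
proof (induction n rule: dec_induct)
  case (step n)
  then show ?case using turan_ratio_Suc_le[OF assms(1), of k n] assms(2) by linarith
qed simp

lemma turan_ratio_tendsto:
  assumes "edges F \<noteq> {}"
  shows "turan_ratio k F \<longlonglongrightarrow> turan_density k F"
proof -
  \<comment> \<open>The shift by \<open>k\<close> skips the initial zeros, which would spoil
    monotonicity.\<close>
  let ?b = "\<lambda>n. turan_ratio k F (n + k)"
  have "decseq ?b"
    by (intro decseq_SucI) (simp only: add_Suc, rule turan_ratio_Suc_le[OF assms], rule le_add2)
  then obtain L where "?b \<longlonglongrightarrow> L"
    by (rule decseq_convergent[where B = 0]) auto
  then have "turan_ratio k F \<longlonglongrightarrow> L" by (rule LIMSEQ_offset)
  then show ?thesis by (simp add: turan_density_def limI)
qed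

lemma turan_density_le_ratio:
  assumes "edges F \<noteq> {}" "k \<le> n"
  shows "turan_density k F \<le> turan_ratio k F n"
  using turan_ratio_antimono[OF assms]
  by (intro LIMSEQ_le_const2[OF turan_ratio_tendsto[OF assms(1)]]) blast

lemma turan_density_nonneg:
  assumes "edges F \<noteq> {}"
  shows "0 \<le> turan_density k F"
  by (rule LIMSEQ_le_const[OF turan_ratio_tendsto[OF assms]]) auto

section \<open>Complete hypergraphs and their copies as vertex sets\<close>

lemma complete_hypergraph_edges_nonempty: "edges (complete_hypergraph k (k + 1)) \<noteq> {}"
  by (simp add: complete_hypergraph_def nsets_eq_empty_iff)

lemma complete_hypergraph_minus_edges_nonempty:
  assumes "k \<ge> 1"
  shows "edges (complete_hypergraph_minus k (k + 2)) \<noteq> {}"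
proof -
  have "{1..k} \<in> nsets {..<k + 2} k" by (auto simp: nsets_def)
  moreover have "{1..k} \<noteq> {..<k}" using assms by (auto simp: set_eq_iff intro!: exI[of _ k])
  ultimately show ?thesis by (auto simp: complete_hypergraph_minus_def)
qed

lemma free_complete_hypergraphD:
  assumes "hypergraph_free (complete_hypergraph k l) H" "U \<subseteq> verts H" "finite U" "card U = l"
  shows "\<not> nsets U k \<subseteq> edges H"
proof
  assume U: "nsets U k \<subseteq> edges H"
  obtain f where "bij_betw f {..<l} U"
    using assms(3,4) by (metis bij_betw_iff_card card_lessThan finite_lessThan)
  then have f: "inj_on f {..<l}" "f ` {..<l} = U" by (auto simp: bij_betw_def)
  have "f ` e \<in> nsets U k" if "e \<in> nsets {..<l} k" for e
    using that f by (auto simp: nsets_def card_image inj_on_subset)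
  then have "contains_copy H (complete_hypergraph k l)"
    using f U assms(2) unfolding contains_copy_def complete_hypergraph_def fst_conv snd_conv by blast
  with assms(1) show False by (simp add: hypergraph_free_def)
qed

text \<open>An embedding may carry the fixed missing edge \<open>{..<k}\<close> to any
  \<open>k\<close>-subset of its image, which takes the role of \<open>e0\<close>.\<close>

lemma free_complete_hypergraph_minusI:
  assumes "k \<le> l"
    and "\<And>W e0. W \<subseteq> verts H \<Longrightarrow> finite W \<Longrightarrow> card W = l \<Longrightarrow> e0 \<in> nsets W k \<Longrightarrow>
           \<not> nsets W k - {e0} \<subseteq> edges H"
  shows "hypergraph_free (complete_hypergraph_minus k l) H"
proof -
  have False if copy: "contains_copy H (complete_hypergraph_minus k l)"
  proof -
    from copy obtain f where f: "inj_on f {..<l}" "f ` {..<l} \<subseteq> verts H"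
      and fe: "\<forall>e\<in>nsets {..<l} k - {{..<k}}. f ` e \<in> edges H"
      by (auto simp: contains_copy_def complete_hypergraph_minus_def)
    have sub: "{..<k} \<subseteq> {..<l}" using assms(1) by auto
    have "f ` {..<k} \<in> nsets (f ` {..<l}) k"
      using f(1) sub by (auto simp: nsets_def card_image inj_on_subset)
    moreover have "S \<in> edges H" if "S \<in> nsets (f ` {..<l}) k - {f ` {..<k}}" for S
    proof -
      from that obtain e where e: "e \<subseteq> {..<l}" "S = f ` e"
        by (auto simp: nsets_def subset_image_iff)
      then have "card e = k" using that f(1) by (auto simp: nsets_def card_image inj_on_subset)
      then have "e \<in> nsets {..<l} k - {{..<k}}"
        using e that by (auto simp: nsets_def finite_subset)
      then show ?thesis using fe e(2) by blast
    qed
    ultimately show False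
      using assms(2)[of "f ` {..<l}" "f ` {..<k}"] f by (auto simp: card_image)
  qed
  then show ?thesis by (auto simp: hypergraph_free_def)
qed

text \<open>On \<open>k + 1\<close> vertices at least one edge is absent, and the limit lies below
  this single ratio. For \<open>k \<ge> 4\<close> it guarantees a positive proportion of non-edges
  that can be filled.\<close>

lemma turan_density_complete_lt_1:
  assumes "k \<ge> 1"
  shows "turan_density k (complete_hypergraph k (k + 1)) < 1"
proof -
  let ?F = "complete_hypergraph k (k + 1)"
  obtain H :: "nat hypergraph" where H: "uniform_hypergraph k H" "verts H = {..<k + 1}"
    "hypergraph_free ?F H" "card (edges H) = turan_number k (k + 1) ?F"
    using turan_number_attained[OF complete_hypergraph_edges_nonempty] .
  have "edges H \<subset> nsets {..<k + 1} k"
    using free_complete_hypergraphD[OF H(3), of "{..<k + 1}"] H(1,2)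
    by (auto simp: uniform_hypergraph_def)
  then have "card (edges H) < card (nsets {..<k + 1} k)"
    by (intro psubset_card_mono finite_imp_finite_nsets) simp_all
  then have "turan_number k (k + 1) ?F < (k + 1) choose k"
    using H(4) by (simp add: card_nsets)
  then have "turan_ratio k ?F (k + 1) < 1" by (simp del: binomial_Suc_n)
  then show ?thesis
    by (rule le_less_trans[OF turan_density_le_ratio[OF complete_hypergraph_edges_nonempty le_add1]])
qed

section \<open>Asymptotics normalised by powers\<close>

lemma binomial_over_power_tendsto:
  "(\<lambda>n. real (n choose k) / real n ^ k) \<longlonglongrightarrow> 1 / fact k"
proof -
  have "(\<lambda>n. (real n - real i) / real n) \<longlonglongrightarrow> 1" for i
  proof -
    have "(\<lambda>n. 1 - real i / real n) \<longlonglongrightarrow> 1 - 0"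
      by (intro tendsto_diff tendsto_const lim_const_over_n)
    moreover have "\<forall>\<^sub>F n in sequentially. 1 - real i / real n = (real n - real i) / real n"
      using eventually_gt_at_top[of 0] by eventually_elim (simp add: field_simps)
    ultimately have "(\<lambda>n. (real n - real i) / real n) \<longlonglongrightarrow> 1 - 0"
      by (rule Lim_transform_eventually)
    then show ?thesis by simp
  qed
  then have "(\<lambda>n. (\<Prod>i = 0..<k. (real n - real i) / real n) / fact k) \<longlonglongrightarrow> (\<Prod>i = 0..<k. 1) / fact k"
    by (intro tendsto_divide tendsto_prod tendsto_const) auto
  moreover have "real (n choose k) / real n ^ k = (\<Prod>i = 0..<k. (real n - real i) / real n) / fact k" for n
    by (simp add: binomial_gbinomial gbinomial_prod_rev prod_dividef)
  ultimately show ?thesis by simp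
qed

lemma binomial_mult_over_power_tendsto:
  assumes "N > 0"
  shows "(\<lambda>m. real (N * m choose k) / real m ^ k) \<longlonglongrightarrow> real N ^ k / fact k"
proof -
  have "(\<lambda>m. real (N * m choose k) / real (N * m) ^ k * real N ^ k) \<longlonglongrightarrow> 1 / fact k * real N ^ k"
    using assms mult_nat_left_at_top
    by (intro tendsto_mult tendsto_const filterlim_compose[OF binomial_over_power_tendsto]) auto
  moreover have "real (N * m choose k) / real (N * m) ^ k * real N ^ k = real (N * m choose k) / real m ^ k" for m
    using assms by (simp add: power_mult_distrib)
  ultimately show ?thesis by simp
qed

lemma turan_number_over_power_tendsto:
  assumes "edges F \<noteq> {}" "N > 0"
  shows "(\<lambda>m. real (turan_number k (N * m) F) / real m ^ k)
           \<longlonglongrightarrow> turan_density k F * (real N ^ k / fact k)"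
proof -
  have lim: "filterlim (\<lambda>m. N * m) sequentially sequentially"
    using assms(2) by (simp add: mult_nat_left_at_top)
  have "(\<lambda>m. turan_ratio k F (N * m) * (real (N * m choose k) / real m ^ k))
           \<longlonglongrightarrow> turan_density k F * (real N ^ k / fact k)"
    by (intro tendsto_mult binomial_mult_over_power_tendsto assms(2)
          filterlim_compose[OF turan_ratio_tendsto[OF assms(1)] lim])
  moreover have "\<forall>\<^sub>F m in sequentially. turan_ratio k F (N * m) * (real (N * m choose k) / real m ^ k)
      = real (turan_number k (N * m) F) / real m ^ k"
    using eventually_ge_at_top[of k]
  proof eventually_elim
    case (elim m)
    then have "k \<le> N * m" using assms(2) by (metis Suc_leI le_trans mult_le_mono1 mult_1 One_nat_def)
    then show ?case by (simp add: zero_less_binomial)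
  qed
  ultimately show ?thesis by (rule Lim_transform_eventually)
qed

text \<open>The full sequence converges, so constructions on multiples of \<open>N\<close> alone
  already bound the density from below.\<close>

lemma turan_density_geI:
  assumes "edges F \<noteq> {}" "N > 0"
    and lim: "(\<lambda>m. g m / real m ^ k) \<longlonglongrightarrow> L"
    and le: "\<And>m. g m \<le> real (turan_number k (N * m) F)"
  shows "L * fact k / real N ^ k \<le> turan_density k F"
proof -
  have "L \<le> turan_density k F * (real N ^ k / fact k)"
    using le by (intro LIMSEQ_le[OF lim turan_number_over_power_tendsto[OF assms(1,2)]])
      (auto intro!: divide_right_mono)
  then show ?thesis using assms(2) by (simp add: field_simps)
qed

section \<open>The Turan density of the tetrahedron\<close>

text \<open>
  Here \<open>h\<close> is the edge indicator of a \<open>K\<^sub>4\<close>-free 3-graph. Let \<open>j\<close> be the number of edges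
  on four vertices, so \<open>j \<le> 3\<close>. Among the five 4-subtuples of a 5-tuple not all have \<open>j = 3\<close>, since each edge is
  counted twice; hence the values \<open>j (j - 2)\<close> add up to at most 12. This bounds the sum of the squared
  codegrees from above, improving on de Caen's \<open>j \<le> 3\<close>, and Cauchy-Schwarz bounds it from below.
\<close>

lemma triple_sum_bound:
  fixes h :: "nat \<Rightarrow> nat \<Rightarrow> nat \<Rightarrow> int"
  assumes h01: "\<And>x y z. h x y z \<in> {0, 1}"
    and sym12: "\<And>x y z. h x y z = h y x z"
    and sym23: "\<And>x y z. h x y z = h x z y"
    and K4: "\<And>x y z w. h x y z + h x y w + h x z w + h y z w \<le> 3"
  shows "45 * (\<Sum>x<n. \<Sum>y<n. \<Sum>z<n. h x y z) \<le> 29 * int n ^ 3"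
proof (cases "n = 0")
  case False
  define S4 where "S4 f = (\<Sum>x<n. \<Sum>y<n. \<Sum>z<n. \<Sum>w<n. f x y z w)"
    for f :: "nat \<Rightarrow> nat \<Rightarrow> nat \<Rightarrow> nat \<Rightarrow> int"
  define E where "E = (\<Sum>x<n. \<Sum>y<n. \<Sum>z<n. h x y z)"
  define S where "S = S4 (\<lambda>x y z w. h x y z * h x y w)"
  define j where "j x y z w = h x y z + h x y w + h x z w + h y z w" for x y z w
  define q :: "int \<Rightarrow> int" where "q a = a * (a - 2)" for a

  \<comment> \<open>These adjacent transpositions generate all renamings of the four summation
    variables.\<close>
  have sw12: "S4 f = S4 (\<lambda>x y z w. f y x z w)" for f
    unfolding S4_def by (rule sum.swap)
  have sw23: "S4 f = S4 (\<lambda>x y z w. f x z y w)" for f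
    unfolding S4_def by (intro sum.cong refl sum.swap)
  have sw34: "S4 f = S4 (\<lambda>x y z w. f x y w z)" for f
    unfolding S4_def by (intro sum.cong refl sum.swap)
  have S4_add: "S4 (\<lambda>x y z w. f x y z w + g x y z w) = S4 f + S4 g" for f g
    unfolding S4_def by (simp add: sum.distrib)
  have S4_diff: "S4 (\<lambda>x y z w. f x y z w - g x y z w) = S4 f - S4 g" for f g
    unfolding S4_def by (simp add: sum_subtractf)
  have S4_mult: "S4 (\<lambda>x y z w. c * f x y z w) = c * S4 f" for f c
    unfolding S4_def by (simp add: sum_distrib_left)

  have L1: "S4 (\<lambda>x y z w. h x y z) = n * E"
    unfolding S4_def E_def by (simp add: sum_distrib_left)
  have L2: "S4 (\<lambda>x y z w. h x y w) = n * E" by (subst sw34) (rule L1)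
  have L3: "S4 (\<lambda>x y z w. h x z w) = n * E" by (subst sw23) (rule L2)
  have L4: "S4 (\<lambda>x y z w. h y z w) = n * E" by (subst sw12) (rule L3)
  \<comment> \<open>Any two of the four triples in a quadruple share two positions, so all six
    product sums equal \<open>S\<close> after renaming.\<close>
  have P2: "S4 (\<lambda>x y z w. h x y z * h x z w) = S"
    unfolding S_def by (subst sw23) (metis sym23)
  have P3: "S4 (\<lambda>x y z w. h x y z * h y z w) = S"
    unfolding P2[symmetric] by (subst sw12) (metis sym12)
  have P4: "S4 (\<lambda>x y z w. h x y w * h x z w) = S"
    unfolding P2[symmetric] by (subst sw34) (metis sym23)
  have P5: "S4 (\<lambda>x y z w. h x y w * h y z w) = S"
    unfolding P4[symmetric] by (subst sw12) (metis sym12)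
  have P6: "S4 (\<lambda>x y z w. h x z w * h y z w) = S"
    unfolding P5[symmetric] by (subst sw23) (metis sym12)
  have sq: "h x y z * h x y z = h x y z" for x y z using h01[of x y z] by fastforce
  \<comment> \<open>Since \<open>h\<close> takes only the values 0 and 1, its squares collapse and
    \<open>j * (j - 2)\<close> is twice the sum of the pair products minus \<open>j\<close>.\<close>
  have qj: "q (j x y z w) = 2 * (h x y z * h x y w + h x y z * h x z w + h x y z * h y z w
      + h x y w * h x z w + h x y w * h y z w + h x z w * h y z w)
      - (h x y z + h x y w + h x z w + h y z w)" for x y z w
    unfolding q_def j_def by (simp add: algebra_simps sq)
  have T: "S4 (\<lambda>x y z w. q (j x y z w)) = 12 * S - 4 * (n * E)"
    unfolding qj S4_add S4_diff S4_mult L1 L2 L3 L4 P2 P3 P4 P5 P6 by (simp add: S_def)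

  have five: "q (j x y z w) + q (j x y z v) + q (j x y w v) + q (j x z w v) + q (j y z w v) \<le> 12"
    for x y z w v
  proof -
    have rng: "0 \<le> j a b c d \<and> j a b c d \<le> 3" for a b c d
      using h01[of a b c] h01[of a b d] h01[of a c d] h01[of b c d] K4[of a b c d]
      unfolding j_def by auto
    have q3: "q (j a b c d) \<le> 3 \<and> (j a b c d \<noteq> 3 \<longrightarrow> q (j a b c d) \<le> 0)" for a b c d
    proof -
      have "j a b c d \<in> {0, 1, 2, 3}" using rng[of a b c d] by auto
      then show ?thesis unfolding q_def by auto
    qed
    \<comment> \<open>Five values 3 would give the odd total 15. So at most four \<open>q\<close>
      values equal 3, and the others are at most 0.\<close>
    have "even (j x y z w + j x y z v + j x y w v + j x z w v + j y z w v)"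
      unfolding j_def by simp
    then have "\<not> (j x y z w = 3 \<and> j x y z v = 3 \<and> j x y w v = 3 \<and> j x z w v = 3 \<and> j y z w v = 3)"
      by auto
    then show ?thesis
      using q3[of x y z w] q3[of x y z v] q3[of x y w v] q3[of x z w v] q3[of y z w v] by linarith
  qed
  define f where "f x y z w = q (j x y z w)" for x y z w
  have "(\<Sum>x<n. \<Sum>y<n. \<Sum>z<n. \<Sum>w<n. \<Sum>v<n. f x y z w + f x y z v + f x y w v + f x z w v + f y z w v)
      \<le> (\<Sum>x<n. \<Sum>y<n. \<Sum>z<n. \<Sum>w<n. \<Sum>v<n. 12)"
    unfolding f_def by (intro sum_mono five)
  \<comment> \<open>Each of the five terms ignores one variable, whose summation contributes a
    factor \<open>n\<close>.\<close>
  moreover have "(\<Sum>x<n. \<Sum>y<n. \<Sum>z<n. \<Sum>w<n. \<Sum>v<n. f x y z w + f x y z v + f x y w v + f x z w v + f y z w v)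
      = 5 * (int n * S4 f)"
    unfolding S4_def by (simp add: sum.distrib flip: sum_distrib_left)
  ultimately have "int n * (5 * S4 f) \<le> int n * (12 * int n ^ 4)"
    by (simp add: eval_nat_numeral algebra_simps)
  then have "5 * S4 f \<le> 12 * int n ^ 4" using False by simp
  then have upper: "60 * S - 20 * (n * E) \<le> 12 * int n ^ 4"
    using T unfolding f_def by linarith

  \<comment> \<open>For fixed \<open>x\<close> and \<open>y\<close> the sums over \<open>z\<close>
    and \<open>w\<close> factor, giving a squared codegree.\<close>
  have "S = (\<Sum>x<n. \<Sum>y<n. (\<Sum>z<n. h x y z)\<^sup>2)"
    unfolding S_def S4_def by (simp add: power2_eq_square sum_product)
  then have "9 * S = (\<Sum>x<n. \<Sum>y<n. 9 * (\<Sum>z<n. h x y z)\<^sup>2)"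
    by (simp add: sum_distrib_left)
  also have "\<dots> \<ge> (\<Sum>x<n. \<Sum>y<n. 12 * int n * (\<Sum>z<n. h x y z) - 4 * (int n)\<^sup>2)"
  proof (intro sum_mono)
    fix x y
    \<comment> \<open>tangent line of the square at codegree \<open>2n/3\<close>, near the average\<close>
    have "0 \<le> (3 * (\<Sum>z<n. h x y z) - 2 * int n)\<^sup>2" by simp
    then show "12 * int n * (\<Sum>z<n. h x y z) - 4 * (int n)\<^sup>2 \<le> 9 * (\<Sum>z<n. h x y z)\<^sup>2"
      by (simp add: power2_eq_square algebra_simps)
  qed
  also have "(\<Sum>x<n. \<Sum>y<n. 12 * int n * (\<Sum>z<n. h x y z) - 4 * (int n)\<^sup>2)
      = 12 * int n * E - 4 * int n ^ 4"
    unfolding E_def by (simp add: sum_subtractf eval_nat_numeral flip: sum_distrib_left)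
  \<comment> \<open>Eliminating \<open>S\<close> from 60 times the lower bound and 9 times the upper
    one gives 540 n E at most 348 n^4; division by 12 leaves 45 and 29.\<close>
  finally have "int n * (45 * E) \<le> int n * (29 * int n ^ 3)"
    using upper by (simp add: eval_nat_numeral)
  then show ?thesis using False unfolding E_def by simp
qed simp

lemma card_ordered_triples:
  assumes "card e = 3"
  shows "card {p. {fst p, fst (snd p), snd (snd p)} = e} = 6"
proof -
  obtain a b c where e: "e = {a, b, c}" and d: "a \<noteq> b" "a \<noteq> c" "b \<noteq> c"
    using assms by (metis card_3_iff)
  have "{x, y, z} = {a, b, c} \<longleftrightarrow>
      (x, y, z) \<in> {(a, b, c), (a, c, b), (b, a, c), (b, c, a), (c, a, b), (c, b, a)}"
    (is "?l \<longleftrightarrow> ?r") for x y z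
  proof
    assume ?l
    then have "card {x, y, z} = 3" using d by simp
    then have "x \<noteq> y" "x \<noteq> z" "y \<noteq> z" by (auto simp: card_insert_if split: if_splits)
    moreover have "x \<in> {a, b, c}" "y \<in> {a, b, c}" "z \<in> {a, b, c}" using \<open>?l\<close> by blast+
    ultimately show ?r by simp metis
  next
    assume ?r
    then show ?l by (elim insertE emptyE) (simp_all add: insert_commute)
  qed
  then have "{p. {fst p, fst (snd p), snd (snd p)} = e} =
      {(a, b, c), (a, c, b), (b, a, c), (b, c, a), (c, a, b), (c, b, a)}"
    unfolding e set_eq_iff mem_Collect_eq by (simp only: split_paired_all fst_conv snd_conv) simp
  then show ?thesis using d by simp
qed

text \<open>The sum over ordered triples counts each edge 3! = 6 times, hence 270 = 6 * 45.\<close>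

lemma card_edges_K4_free:
  fixes H :: "nat hypergraph"
  assumes H: "uniform_hypergraph 3 H" "verts H = {..<n}"
    and free: "hypergraph_free (complete_hypergraph 3 4) H"
  shows "270 * card (edges H) \<le> 29 * n ^ 3"
proof -
  define h :: "nat \<Rightarrow> nat \<Rightarrow> nat \<Rightarrow> int" where "h x y z = of_bool ({x, y, z} \<in> edges H)" for x y z
  have edge: "e \<subseteq> {..<n} \<and> card e = 3" if "e \<in> edges H" for e
    using H that by (auto simp: uniform_hypergraph_def nsets_def)
  have K4: "h x y z + h x y w + h x z w + h y z w \<le> 3" for x y z w
  proof (rule ccontr)
    assume "\<not> ?thesis"
    then have E: "{x, y, z} \<in> edges H" "{x, y, w} \<in> edges H" "{x, z, w} \<in> edges H" "{y, z, w} \<in> edges H"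
      unfolding h_def of_bool_def by (auto split: if_splits)
    \<comment> \<open>Four edges among the triples force the four vertices to be distinct, so tuples
      with repetitions satisfy the bound as well.\<close>
    have card3: "a \<noteq> b \<and> b \<noteq> c \<and> a \<noteq> c" if "{a, b, c} \<in> edges H" for a b c
      using edge[OF that] by (auto simp: card_insert_if split: if_splits)
    have d: "x \<noteq> y" "x \<noteq> z" "y \<noteq> z" "x \<noteq> w" "y \<noteq> w" "z \<noteq> w"
      using card3[OF E(1)] card3[OF E(2)] card3[OF E(3)] by auto
    have "nsets {x, y, z, w} 3 \<subseteq> edges H"
      unfolding nsets_3_eq using E by (auto simp: insert_commute)
    moreover have "{x, y, z, w} \<subseteq> verts H" using edge[OF E(1)] edge[OF E(2)] H(2) by auto
    ultimately show False
      using free_complete_hypergraphD[OF free, of "{x, y, z, w}"] d by simp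
  qed
  have "45 * (\<Sum>x<n. \<Sum>y<n. \<Sum>z<n. h x y z) \<le> 29 * int n ^ 3"
    by (intro triple_sum_bound K4) (auto simp: h_def insert_commute)
  moreover have "(\<Sum>x<n. \<Sum>y<n. \<Sum>z<n. h x y z) = int (6 * card (edges H))"
  proof -
    let ?N = "{..<n} \<times> {..<n} \<times> {..<n}"
    let ?t = "\<lambda>p. {fst p, fst (snd p), snd (snd p)}"
    let ?P = "\<lambda>e. {p. ?t p = e}"
    have sub: "?P e \<subseteq> ?N" if "e \<in> edges H" for e
    proof
      fix p assume "p \<in> ?P e"
      then have "?t p \<subseteq> {..<n}" using edge[OF that] by (simp only: mem_Collect_eq)
      then show "p \<in> ?N" by (simp add: mem_Times_iff)
    qed
    have "card (\<Union>e\<in>edges H. ?P e) = (\<Sum>e\<in>edges H. card (?P e))"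
    proof (rule card_UN_disjoint)
      show "finite (edges H)" by (rule uniform_edges_finite[OF H(1)])
      show "\<forall>e\<in>edges H. finite (?P e)"
        by (intro ballI finite_subset[OF sub]) simp_all
    qed auto
    also have "\<dots> = (\<Sum>e\<in>edges H. 6)"
      using edge by (intro sum.cong refl card_ordered_triples) blast
    also have "(\<Union>e\<in>edges H. ?P e) = {p \<in> ?N. ?t p \<in> edges H}"
      using sub by blast
    finally have "card {p \<in> ?N. ?t p \<in> edges H} = 6 * card (edges H)" by simp
    moreover have "(\<Sum>p\<in>?N. of_bool (?t p \<in> edges H)) = int (card {p \<in> ?N. ?t p \<in> edges H})"
      by (subst sum_of_bool_eq) (simp_all add: Collect_conj_eq)
    ultimately show ?thesis
      by (simp only: h_def sum.cartesian_product split_def)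
  qed
  ultimately have "int (270 * card (edges H)) \<le> int (29 * n ^ 3)" by simp
  then show ?thesis by (simp only: of_nat_le_iff)
qed

lemma turan_density_K4_le: "turan_density 3 (complete_hypergraph 3 4) \<le> 29 / 45"
proof -
  let ?F = "complete_hypergraph 3 4"
  have ne: "edges ?F \<noteq> {}" using complete_hypergraph_edges_nonempty[of 3] by simp
  have "real (turan_number 3 n ?F) / real n ^ 3 \<le> 29 / 270" for n
  proof -
    obtain H :: "nat hypergraph" where "uniform_hypergraph 3 H" "verts H = {..<n}"
      "hypergraph_free ?F H" "card (edges H) = turan_number 3 n ?F"
      using turan_number_attained[OF ne] .
    then have "270 * turan_number 3 n ?F \<le> 29 * n ^ 3" by (metis card_edges_K4_free)
    then have "real (270 * turan_number 3 n ?F) \<le> real (29 * n ^ 3)" by (simp only: of_nat_le_iff)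
    then show ?thesis by (cases "n = 0") (simp_all add: field_simps)
  qed
  \<comment> \<open>With \<open>N = 1\<close> this is the whole sequence; the factor
    \<open>fact 3\<close> turns 29/270 into 29/45.\<close>
  moreover have "(\<lambda>m. real (turan_number 3 (1 * m) ?F) / real m ^ 3)
           \<longlonglongrightarrow> turan_density 3 ?F * (real 1 ^ 3 / fact 3)"
    by (rule turan_number_over_power_tendsto[OF ne]) simp
  ultimately have "turan_density 3 ?F * (real 1 ^ 3 / fact 3) \<le> 29 / 270"
    by (intro LIMSEQ_le_const2) auto
  then show ?thesis by (simp add: fact_numeral)
qed

section \<open>Uniformity three\<close>

text \<open>Each of the \<open>m\<close> new vertices gets 3 (10 m)^2 pairs as its link. A copy
  contains at most one new vertex, since no edge has two; it contains exactly one, outside the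
  missing edge, since otherwise \<open>H\<close> would contain a tetrahedron. Its other four
  vertices would then need distinct residues modulo 3.\<close>

lemma turan_number_K5_minus_ge:
  "turan_number 3 (30 * m) (complete_hypergraph 3 4) + 300 * m ^ 3
     \<le> turan_number 3 (31 * m) (complete_hypergraph_minus 3 5)"
proof -
  have ne: "edges (complete_hypergraph 3 4) \<noteq> {}" using complete_hypergraph_edges_nonempty[of 3] by simp
  obtain H :: "nat hypergraph" where H: "uniform_hypergraph 3 H" "verts H = {..<30 * m}"
      "hypergraph_free (complete_hypergraph 3 4) H"
      "card (edges H) = turan_number 3 (30 * m) (complete_hypergraph 3 4)"
    using turan_number_attained[OF ne] .
  \<comment> \<open>The two residues are listed in increasing order, so each unordered pair is coded
    only once and \<open>g\<close> is injective.\<close>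
  define D where "D = {30 * m..<31 * m} \<times> {..<10 * m} \<times> {..<10 * m} \<times> {(0::nat, 1::nat), (0, 2), (1, 2)}"
  \<comment> \<open>a new vertex \<open>a\<close> is joined to all pairs of old vertices with distinct residues modulo 3\<close>
  define g where "g = (\<lambda>(a, i, j, c, d). {a, 3 * i + c, 3 * j + d :: nat})"
  define G where "G = ({..<31 * m}, edges H \<union> g ` D)"
  have edgeH: "e \<subseteq> {..<30 * m} \<and> finite e \<and> card e = 3" if "e \<in> edges H" for e
    using H(1,2) that by (auto simp: uniform_hypergraph_def nsets_def)
  have new: "\<exists>a x y. e = {a, x, y} \<and> 30 * m \<le> a \<and> a < 31 * m \<and> x < 30 * m \<and> y < 30 * m \<and> x mod 3 \<noteq> y mod 3"
    if e: "e \<in> g ` D" for e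
  proof -
    obtain p where p: "p \<in> D" "e = g p" using e by blast
    obtain a i j c d where "p = (a, i, j, c, d)" by (metis prod_cases5)
    with p have "e = {a, 3 * i + c, 3 * j + d}" "30 * m \<le> a" "a < 31 * m"
        "i < 10 * m" "j < 10 * m" "c < d" "d < 3"
      by (auto simp: D_def g_def)
    moreover from this have "(3 * i + c) mod 3 \<noteq> (3 * j + d) mod 3" by simp
    ultimately show ?thesis
      by (intro exI[of _ a] exI[of _ "3 * i + c"] exI[of _ "3 * j + d"]) simp
  qed
  have new_large: "\<exists>a\<in>e. 30 * m \<le> a" if "e \<in> g ` D" for e
    using new[OF that] by blast
  have new_unique: "\<exists>a. \<forall>b\<in>e. 30 * m \<le> b \<longrightarrow> b = a" if e: "e \<in> g ` D" for e
  proof -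
    obtain a x y where "e = {a, x, y}" "x < 30 * m" "y < 30 * m" using new[OF e] by blast
    then show ?thesis by (intro exI[of _ a]) auto
  qed
  have inj: "inj_on g D"
  proof (rule inj_onI)
    fix p p' assume p: "p \<in> D" "p' \<in> D" "g p = g p'"
    obtain a i j c d where e: "p = (a, i, j, c, d)" by (metis prod_cases5)
    obtain a' i' j' c' d' where e': "p' = (a', i', j', c', d')" by (metis prod_cases5)
    have b: "30 * m \<le> a" "i < 10 * m" "j < 10 * m" "c < d" "d < 3"
      "30 * m \<le> a'" "i' < 10 * m" "j' < 10 * m" "c' < d'" "d' < 3"
      using p(1,2) unfolding e e' D_def by auto
    have eq: "{a, 3 * i + c, 3 * j + d} = {a', 3 * i' + c', 3 * j' + d'}"
      using p(3) unfolding e e' g_def by simp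
    have "a' \<in> {a, 3 * i + c, 3 * j + d}" unfolding eq by simp
    then have "a = a'" using b by auto
    have "{a, 3 * i + c, 3 * j + d} - {a} = {3 * i + c, 3 * j + d}" using b by auto
    moreover have "{a', 3 * i' + c', 3 * j' + d'} - {a'} = {3 * i' + c', 3 * j' + d'}" using b by auto
    ultimately have "{3 * i + c, 3 * j + d} = {3 * i' + c', 3 * j' + d'}" using eq \<open>a = a'\<close> by metis
    then consider "3 * i + c = 3 * i' + c'" "3 * j + d = 3 * j' + d'"
      | "3 * i + c = 3 * j' + d'" "3 * j + d = 3 * i' + c'"
      by (auto simp only: doubleton_eq_iff)
    moreover have digit: "r = r' \<and> s = s'"
      if "3 * r + s = 3 * r' + s'" "s < 3" "s' < 3" for r r' s s' :: nat
      using that by presburger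
    moreover have "c < 3" "c' < 3" using b by linarith+
    ultimately have "i = i' \<and> j = j' \<and> c = c' \<and> d = d'"
      using b(4,5,9,10) by cases (metis less_asym)+
    then show "p = p'" using \<open>a = a'\<close> e e' by simp
  qed
  have "card D = 300 * m ^ 3" unfolding D_def by (simp add: card_cartesian_product power3_eq_cube)
  then have "card (g ` D) = 300 * m ^ 3" using inj by (simp add: card_image)
  moreover have "edges H \<inter> g ` D = {}"
  proof -
    have False if "e \<in> edges H" "e \<in> g ` D" for e
      using edgeH[OF that(1)] new[OF that(2)] by auto
    then show ?thesis by blast
  qed
  moreover have "finite (g ` D)" unfolding D_def by simp
  ultimately have cardG: "card (edges G) = turan_number 3 (30 * m) (complete_hypergraph 3 4) + 300 * m ^ 3"
    unfolding G_def using H(4) uniform_edges_finite[OF H(1)] by (simp add: card_Un_disjoint)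
  have "uniform_hypergraph 3 G"
  proof -
    have "e \<in> nsets {..<31 * m} 3" if "e \<in> edges H" for e
      using edgeH[OF that] by (auto simp: nsets_def)
    moreover have "e \<in> nsets {..<31 * m} 3" if e: "e \<in> g ` D" for e
    proof -
      obtain a x y where "e = {a, x, y}" "30 * m \<le> a" "a < 31 * m" "x < 30 * m" "y < 30 * m" "x mod 3 \<noteq> y mod 3"
        using new[OF e] by metis
      moreover from this have "x \<noteq> y" "a \<noteq> x" "a \<noteq> y" by auto
      ultimately show ?thesis by (simp add: nsets_def)
    qed
    ultimately show ?thesis unfolding uniform_hypergraph_def G_def by auto
  qed
  moreover have "hypergraph_free (complete_hypergraph_minus 3 5) G"
  proof (rule free_complete_hypergraph_minusI)
    fix W e0 assume W: "W \<subseteq> verts G" "finite W" "card W = 5" "e0 \<in> nsets W 3"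
    show "\<not> nsets W 3 - {e0} \<subseteq> edges G"
    proof
      assume sub: "nsets W 3 - {e0} \<subseteq> edges G"
      have edgeG: "S \<in> edges H \<or> S \<in> g ` D" if "S \<in> nsets W 3" "S \<noteq> e0" for S
        using sub that by (auto simp: G_def)
      \<comment> \<open>Deleting a vertex of \<open>e0\<close> leaves four vertices with no triple
        missing.\<close>
      have no: "\<not> W - {v} \<subseteq> {..<30 * m}" if "v \<in> e0" for v
      proof
        assume v: "W - {v} \<subseteq> {..<30 * m}"
        have "S \<in> edges H" if S: "S \<in> nsets (W - {v}) 3" for S
        proof -
          have "S \<in> nsets W 3" "S \<noteq> e0" "S \<subseteq> {..<30 * m}"
            using S v \<open>v \<in> e0\<close> by (auto simp: nsets_def)
          then show ?thesis using edgeG[of S] new_large[of S] by force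
        qed
        moreover have "card (W - {v}) = 4"
          using W(2-4) that by (auto simp: nsets_def)
        ultimately show False
          using free_complete_hypergraphD[OF H(3), of "W - {v}"] v H(2) W(2) by auto
      qed
      \<comment> \<open>Two new vertices of the copy would share a triple other than
        \<open>e0\<close>, but edges contain at most one new vertex.\<close>
      have one: "a = a'" if a: "a \<in> W" "a' \<in> W" "30 * m \<le> a" "30 * m \<le> a'" for a a'
      proof (rule ccontr)
        assume "a \<noteq> a'"
        then have "card {a, a'} = 2" by simp
        moreover have "card e0 = 3" using W(4) by (simp add: nsets_def)
        ultimately have "\<exists>S\<in>nsets W 3. S \<noteq> e0 \<and> {a, a'} \<subseteq> S"
          using W a(1,2) by (intro nsets_minus_one_cover) auto
        then obtain S where S: "S \<in> nsets W 3" "S \<noteq> e0" "{a, a'} \<subseteq> S" by blast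
        from edgeG[OF S(1,2)] show False
        proof
          assume "S \<in> edges H"
          then show False using edgeH[of S] S(3) a(3) by auto
        next
          assume "S \<in> g ` D"
          then obtain b where "\<forall>c\<in>S. 30 * m \<le> c \<longrightarrow> c = b" using new_unique by blast
          then show False using S(3) a(3,4) \<open>a \<noteq> a'\<close> by auto
        qed
      qed
      obtain v where v: "v \<in> e0" using W(4) by (force simp: nsets_def)
      then obtain a where a: "a \<in> W" "30 * m \<le> a" using no[OF v] by fastforce
      have rest: "W - {a} \<subseteq> {..<30 * m}" using one a by fastforce
      then have "a \<notin> e0" using no by blast
      \<comment> \<open>As \<open>a\<close> is not in \<open>e0\<close>, every triple through
        \<open>a\<close> is present and is a new edge, so its old vertices have distinct
        residues.\<close>
      have "inj_on (\<lambda>x. x mod 3) (W - {a})"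
      proof (rule inj_onI, rule ccontr)
        fix x y assume x: "x \<in> W - {a}" and y: "y \<in> W - {a}" and eq: "x mod 3 = y mod 3" and "x \<noteq> y"
        then have "{a, x, y} \<in> nsets W 3" "{a, x, y} \<noteq> e0"
          using a \<open>a \<notin> e0\<close> by (auto simp: nsets_def)
        moreover have "{a, x, y} \<notin> edges H" using edgeH[of "{a, x, y}"] a(2) by auto
        ultimately obtain a' x' y' where n: "{a, x, y} = {a', x', y'}" "30 * m \<le> a'"
            "x' < 30 * m" "y' < 30 * m" "x' mod 3 \<noteq> y' mod 3"
          using edgeG new by metis
        have "x < 30 * m" "y < 30 * m" using rest x y by auto
        have "a' \<in> {a, x, y}" unfolding n(1) by simp
        then have "a' = a" using n(2) \<open>x < 30 * m\<close> \<open>y < 30 * m\<close> by auto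
        have "x' \<in> {a, x, y}" "y' \<in> {a, x, y}" unfolding n(1) by simp_all
        then have "x' \<in> {x, y}" "y' \<in> {x, y}" using n(3,4) a(2) by auto
        then show False using n(5) eq by auto
      qed
      then have "card (W - {a}) \<le> card {..<3::nat}"
        by (rule card_inj_on_le) auto
      then show False using W(2,3) a(1) by simp
    qed
  qed simp
  ultimately show ?thesis
    using card_edges_le_turan_number[of 3 G] cardG by (simp add: G_def)
qed

lemma turan_density_K4_less_K5_minus:
  "turan_density 3 (complete_hypergraph 3 4) < turan_density 3 (complete_hypergraph_minus 3 5)"
proof -
  let ?F = "complete_hypergraph 3 4" and ?F' = "complete_hypergraph_minus 3 5"
  let ?p = "turan_density 3 ?F"
  have ne: "edges ?F \<noteq> {}" using complete_hypergraph_edges_nonempty[of 3] by simp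
  have ne': "edges ?F' \<noteq> {}" using complete_hypergraph_minus_edges_nonempty[of 3] by simp
  have "(\<lambda>m. real (turan_number 3 (30 * m) ?F) / real m ^ 3 + 300) \<longlonglongrightarrow> ?p * (real 30 ^ 3 / fact 3) + 300"
    by (intro tendsto_add tendsto_const turan_number_over_power_tendsto[OF ne]) simp
  moreover have "\<forall>\<^sub>F m in sequentially. real (turan_number 3 (30 * m) ?F) / real m ^ 3 + 300
      = (real (turan_number 3 (30 * m) ?F) + 300 * real m ^ 3) / real m ^ 3"
    using eventually_gt_at_top[of 0] by eventually_elim (simp add: field_simps)
  ultimately have lim: "(\<lambda>m. (real (turan_number 3 (30 * m) ?F) + 300 * real m ^ 3) / real m ^ 3)
      \<longlonglongrightarrow> ?p * (real 30 ^ 3 / fact 3) + 300"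
    by (rule Lim_transform_eventually)
  have "(?p * (real 30 ^ 3 / fact 3) + 300) * fact 3 / real 31 ^ 3 \<le> turan_density 3 ?F'"
  proof (rule turan_density_geI[OF ne' _ lim])
    fix m
    have "real (turan_number 3 (30 * m) ?F + 300 * m ^ 3) \<le> real (turan_number 3 (31 * m) ?F')"
      using turan_number_K5_minus_ge[of m] by (simp only: of_nat_le_iff)
    then show "real (turan_number 3 (30 * m) ?F) + 300 * real m ^ 3 \<le> real (turan_number 3 (31 * m) ?F')"
      by simp
  qed simp
  then have "(27000 * ?p + 1800) / 29791 \<le> turan_density 3 ?F'"
    by (simp add: fact_numeral algebra_simps)
  \<comment> \<open>The bound exceeds \<open>?p\<close> exactly when \<open>?p\<close> is below
    1800/2791, which is just above 29/45. With one new vertex per \<open>N\<close> old ones, 30 is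
    the least \<open>N\<close> for which this works.\<close>
  then show ?thesis using turan_density_K4_le by simp
qed

section \<open>Uniformity at least four\<close>

text \<open>Fix three elements, send them to layers 0, 1, 2 and the others to later layers. This
  crude count has the right order and is the gain per non-edge.\<close>

lemma card_transversal_maps_ge:
  fixes T :: "'a set"
  assumes T: "finite T" "card T = k" and "k \<ge> 3" "M \<ge> 3"
  shows "(M - 3) ^ (k - 3) \<le> card {g \<in> T \<rightarrow>\<^sub>E {..<M}. \<forall>i<3. card {x \<in> T. g x = i} = 1}"
proof -
  obtain X where X: "X \<subseteq> T" "card X = 3" using obtain_subset_with_card_n[of 3 T] assms by auto
  then obtain a b c where abc: "X = {a, b, c}" "a \<noteq> b" "a \<noteq> c" "b \<noteq> c" by (metis card_3_iff)
  define F :: "'a \<Rightarrow> nat set" where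
    "F x = (if x = a then {0} else if x = b then {1} else if x = c then {2} else {3..<M})" for x
  have "card (PiE T F) = (\<Prod>x\<in>T. card (F x))" using T(1) by (rule card_PiE)
  also have "\<dots> = (\<Prod>x\<in>T - X. card (F x)) * (\<Prod>x\<in>X. card (F x))"
    using X(1) T(1) by (rule prod.subset_diff)
  also have "(\<Prod>x\<in>X. card (F x)) = 1" using abc by (simp add: F_def)
  also have "(\<Prod>x\<in>T - X. card (F x)) = (\<Prod>x\<in>T - X. M - 3)"
    unfolding abc(1) F_def by (intro prod.cong) auto
  also have "\<dots> = (M - 3) ^ (k - 3)"
    using X T by (simp add: card_Diff_subset finite_subset)
  finally have card_F: "(M - 3) ^ (k - 3) = card (PiE T F)" by simp
  have sub: "PiE T F \<subseteq> {g \<in> T \<rightarrow>\<^sub>E {..<M}. \<forall>i<3. card {x \<in> T. g x = i} = 1}"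
  proof
    fix g assume g: "g \<in> PiE T F"
    have F: "g x \<in> F x" if "x \<in> T" for x using g that by auto
    have abcT: "a \<in> T" "b \<in> T" "c \<in> T" using X(1) abc(1) by auto
    have F_M: "F x \<subseteq> {..<M}" for x using assms(4) by (auto simp: F_def)
    then have "g \<in> T \<rightarrow>\<^sub>E {..<M}" using g by (auto simp: PiE_iff)
    moreover have "card {x \<in> T. g x = i} = 1" if "i < 3" for i
    proof -
      have iff: "g x = 0 \<longleftrightarrow> x = a" "g x = 1 \<longleftrightarrow> x = b" "g x = 2 \<longleftrightarrow> x = c" if "x \<in> T" for x
        using F[OF that] abc(2-4) by (auto simp: F_def split: if_splits)
      have "{x \<in> T. g x = 0} = {a}" "{x \<in> T. g x = 1} = {b}" "{x \<in> T. g x = 2} = {c}"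
        using abcT by (auto simp only: iff set_eq_iff mem_Collect_eq singleton_iff)
      moreover have "i = 0 \<or> i = 1 \<or> i = 2" using that by auto
      ultimately show ?thesis by auto
    qed
    ultimately show "g \<in> {g \<in> T \<rightarrow>\<^sub>E {..<M}. \<forall>i<3. card {x \<in> T. g x = i} = 1}" by blast
  qed
  have fin: "finite {g \<in> T \<rightarrow>\<^sub>E {..<M}. \<forall>i<3. card {x \<in> T. g x = i} = 1}"
    using T(1) by (intro finite_subset[OF _ finite_PiE[of T "\<lambda>_. {..<M}"]]) auto
  show ?thesis unfolding card_F by (rule card_mono[OF fin sub])
qed

text \<open>Union bound over the 4-subsets mapped into the first three layers, with 3^4 = 81. This
  is the loss per edge, stated additively to avoid truncated subtraction.\<close>

lemma card_maps_few_small_ge: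
  fixes T :: "'a set"
  assumes T: "finite T" "card T = k"
  shows "M ^ k \<le> card {g \<in> T \<rightarrow>\<^sub>E {..<M}. card {x \<in> T. g x < 3} \<le> 3} + (k choose 4) * (81 * M ^ (k - 4))"
proof -
  let ?A = "{g \<in> T \<rightarrow>\<^sub>E {..<M}. card {x \<in> T. g x < 3} \<le> 3}"
  define B where "B X = PiE T (\<lambda>x. if x \<in> X then {..<3} else {..<M})" for X
  have finN: "finite (nsets T 4)" using T(1) by (rule finite_imp_finite_nsets)
  have fin: "finite (T \<rightarrow>\<^sub>E {..<M})" using T(1) by (intro finite_PiE) auto
  have finB: "finite (B X)" for X unfolding B_def using T(1) by (intro finite_PiE) auto
  have cardB: "card (B X) = 81 * M ^ (k - 4)" if "X \<in> nsets T 4" for X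
  proof -
    have X: "X \<subseteq> T" "finite X" "card X = 4" using that by (auto simp: nsets_def)
    have "card (B X) = (\<Prod>x\<in>T. if x \<in> X then 3 else M)"
      unfolding B_def using T(1) by (subst card_PiE) (auto intro!: prod.cong)
    also have "\<dots> = 3 ^ card (T \<inter> X) * M ^ card (T \<inter> - X)"
      using T(1) by (simp add: prod.If_cases)
    also have "T \<inter> X = X" using X(1) by auto
    also have "T \<inter> - X = T - X" by auto
    finally show ?thesis using X T by (simp add: card_Diff_subset)
  qed
  have "T \<rightarrow>\<^sub>E {..<M} \<subseteq> ?A \<union> (\<Union>X\<in>nsets T 4. B X)"
  proof
    fix g assume g: "g \<in> T \<rightarrow>\<^sub>E {..<M}"
    show "g \<in> ?A \<union> (\<Union>X\<in>nsets T 4. B X)"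
    proof (cases "card {x \<in> T. g x < 3} \<le> 3")
      case False
      then obtain X where X: "X \<subseteq> {x \<in> T. g x < 3}" "card X = 4" "finite X"
        using obtain_subset_with_card_n[of 4 "{x \<in> T. g x < 3}"] by auto
      then have "X \<in> nsets T 4" "g \<in> B X" using g unfolding B_def nsets_def PiE_iff by auto
      then show ?thesis by blast
    qed (use g in blast)
  qed
  then have "card (T \<rightarrow>\<^sub>E {..<M}) \<le> card (?A \<union> (\<Union>X\<in>nsets T 4. B X))"
    using fin finN finB by (intro card_mono) auto
  also have "\<dots> \<le> card ?A + card (\<Union>X\<in>nsets T 4. B X)" by (rule card_Un_le)
  also have "card (\<Union>X\<in>nsets T 4. B X) \<le> (\<Sum>X\<in>nsets T 4. card (B X))"
    using finN by (rule card_UN_le)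
  also have "\<dots> = (k choose 4) * (81 * M ^ (k - 4))"
    using T by (simp add: cardB card_nsets)
  finally show ?thesis using T by (simp add: card_PiE)
qed

section \<open>The enriched blow-up\<close>

definition transversal :: "('a \<times> nat) set \<Rightarrow> bool" where
  "transversal S \<longleftrightarrow> (\<forall>i<3. card {s \<in> S. snd s = i} = 1)"

text \<open>The second coordinate is the layer. \<open>inj_on fst S\<close> constrains the added
  transversal sets too, so that a forbidden copy projects to \<open>H\<close> without merging
  vertices.\<close>

definition enriched_blowup :: "nat \<Rightarrow> nat \<Rightarrow> 'a hypergraph \<Rightarrow> ('a \<times> nat) hypergraph" where
  "enriched_blowup k M H =
     (verts H \<times> {..<M},
      {S \<in> nsets (verts H \<times> {..<M}) k. inj_on fst S \<and>
         (transversal S \<or> fst ` S \<in> edges H \<and> card {s \<in> S. snd s < 3} \<le> 3)})"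

lemma uniform_enriched_blowup:
  "finite (verts H) \<Longrightarrow> uniform_hypergraph k (enriched_blowup k M H)"
  by (auto simp: uniform_hypergraph_def enriched_blowup_def)

lemma card_snd_less_3:
  assumes "finite W"
  shows "card {s \<in> W. snd s < (3::nat)} = card {s \<in> W. snd s = 0} + card {s \<in> W. snd s = 1} + card {s \<in> W. snd s = 2}"
proof -
  have "{s \<in> W. snd s < (3::nat)} = ({s \<in> W. snd s = 0} \<union> {s \<in> W. snd s = 1}) \<union> {s \<in> W. snd s = 2}"
    by auto
  moreover have "card \<dots> = card ({s \<in> W. snd s = 0} \<union> {s \<in> W. snd s = 1}) + card {s \<in> W. snd s = 2}"
    using assms by (intro card_Un_disjoint) auto
  moreover have "card ({s \<in> W. snd s = 0} \<union> {s \<in> W. snd s = 1}) = card {s \<in> W. snd s = 0} + card {s \<in> W. snd s = 1}"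
    using assms by (intro card_Un_disjoint) auto
  ultimately show ?thesis by simp
qed

lemma enriched_blowup_free:
  assumes H: "uniform_hypergraph k H" "hypergraph_free (complete_hypergraph k (k + 1)) H"
    and k: "k \<ge> 4"
  shows "hypergraph_free (complete_hypergraph_minus k (k + 2)) (enriched_blowup k M H)"
proof (rule free_complete_hypergraph_minusI)
  fix W e0
  let ?G = "enriched_blowup k M H"
  assume W: "W \<subseteq> verts ?G" "finite W" "card W = k + 2" and e0: "e0 \<in> nsets W k"
  have e0': "e0 \<subseteq> W" "finite e0" "card e0 = k" using e0 by (auto simp: nsets_def)
  have e0_ne: "e0 \<noteq> {}" using e0'(3) k by auto
  show "\<not> nsets W k - {e0} \<subseteq> edges ?G"
  proof
    assume sub: "nsets W k - {e0} \<subseteq> edges ?G"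
    have edge: "inj_on fst S \<and> (transversal S \<or> fst ` S \<in> edges H \<and> card {s \<in> S. snd s < 3} \<le> 3)"
      if "S \<in> nsets W k" "S \<noteq> e0" for S
      using sub that by (auto simp: enriched_blowup_def)
    \<comment> \<open>Transversal sets have exactly three vertices in the first three layers, so the
      bound holds for both kinds of edges.\<close>
    have small: "card {s \<in> S. snd s < 3} \<le> 3" if S: "S \<in> nsets W k" "S \<noteq> e0" for S
    proof -
      have "finite S" using S by (simp add: nsets_def)
      then have "card {s \<in> S. snd s < 3} = 3" if "transversal S"
        using that by (simp add: card_snd_less_3 transversal_def)
      then show ?thesis using edge[OF S] by auto
    qed
    have inj: "inj_on fst W"
    proof (rule inj_onI, rule ccontr)
      fix s t assume st: "s \<in> W" "t \<in> W" "fst s = fst t" "s \<noteq> t"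
      then have "card {s, t} = 2" by simp
      moreover from this have "{s, t} \<noteq> e0" using e0'(3) k by auto
      ultimately obtain S where S: "S \<in> nsets W k" "S \<noteq> e0" "{s, t} \<subseteq> S"
        using nsets_minus_one_cover[of "{s, t}" W k e0] st W(2,3) e0 k by auto
      then have "s = t" using edge[OF S(1,2)] st(3) by (meson inj_onD insert_subset)
      with st(4) show False by simp
    qed
    let ?A = "{s \<in> W. snd s < 3}"
    have finA: "finite ?A" using W(2) by simp
    \<comment> \<open>Otherwise \<open>X\<close> would lie in an edge, which has at most three such
      vertices. Hence \<open>e0\<close> is the only possible 4-subset of \<open>?A\<close>, and then
      \<open>k = 4\<close>.\<close>
    have four: "X = e0" if X: "X \<subseteq> ?A" "card X = 4" for X
    proof (rule ccontr)
      assume "X \<noteq> e0"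
      then obtain S where S: "S \<in> nsets W k" "S \<noteq> e0" "X \<subseteq> S"
        using nsets_minus_one_cover[of X W k e0] X W(2,3) e0 k by auto
      have "finite S" using S by (simp add: nsets_def)
      then have "card X \<le> card {s \<in> S. snd s < 3}"
        using S(3) X(1) by (intro card_mono) auto
      then show False using small[OF S(1,2)] X(2) by simp
    qed
    \<comment> \<open>Deleting a suitable vertex of the missing edge leaves one of the three layers
      empty, so that no transversal set remains.\<close>
    have "\<exists>g\<in>e0. \<exists>i<3. \<forall>s\<in>W - {g}. snd s \<noteq> i"
    proof (cases "\<exists>i<3. {s \<in> W. snd s = i} = {}")
      case True
      moreover obtain g where "g \<in> e0" using e0_ne by blast
      ultimately show ?thesis by blast
    next
      case False
      have pos: "card {s \<in> W. snd s = i} \<ge> 1" if "i < 3" for i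
        using False that W(2) by (simp add: Suc_le_eq card_gt_0_iff)
      have sum: "card ?A = card {s \<in> W. snd s = 0} + card {s \<in> W. snd s = 1} + card {s \<in> W. snd s = 2}"
        using W(2) by (rule card_snd_less_3)
      have "\<exists>g\<in>e0. snd g < 3 \<and> card {s \<in> W. snd s = snd g} = 1"
      proof (cases "card ?A \<ge> 4")
        case True
        obtain X where "X \<subseteq> ?A" "card X = 4" "finite X"
          using obtain_subset_with_card_n[OF True] .
        then have "e0 \<subseteq> ?A" using four by blast
        obtain y where y: "y \<in> e0" using e0_ne by blast
        \<comment> \<open>A 4-subset avoiding \<open>y\<close> would have to be \<open>e0\<close>,
          which contains \<open>y\<close>.\<close>
        have "\<not> card (?A - {y}) \<ge> 4"
        proof
          assume ge: "card (?A - {y}) \<ge> 4"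
          obtain X where "X \<subseteq> ?A - {y}" "card X = 4" "finite X"
            using obtain_subset_with_card_n[OF ge] .
          then show False using four[of X] y by blast
        qed
        then have "card ?A = 4" using True finA by (simp add: card_Diff_singleton_if split: if_splits)
        then have "?A = e0" using four by blast
        \<comment> \<open>Four vertices cannot fill three layers with two or more in each.\<close>
        have "\<exists>i<3. card {s \<in> W. snd s = i} = 1"
        proof (rule ccontr)
          assume "\<not> ?thesis"
          then have "card {s \<in> W. snd s = i} \<ge> 2" if "i < 3" for i using pos[OF that] that by fastforce
          from this[of 0] this[of 1] this[of 2] sum \<open>card ?A = 4\<close> show False by simp
        qed
        then obtain i where i: "i < 3" "card {s \<in> W. snd s = i} = 1" by blast
        then obtain g where "{s \<in> W. snd s = i} = {g}" by (metis card_1_singletonE)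
        then have "g \<in> W" "snd g = i" by auto
        then have "g \<in> e0" using i \<open>?A = e0\<close> by blast
        then show ?thesis using i \<open>snd g = i\<close> by blast
      next
        case False
        then have one: "card {s \<in> W. snd s = i} = 1" if "i < 3" for i
        proof -
          have "i = 0 \<or> i = 1 \<or> i = 2" using that by auto
          then show ?thesis using False sum pos[of 0] pos[of 1] pos[of 2] by auto
        qed
        have "card ?A = 3" using sum one by simp
        \<comment> \<open>Only two vertices of \<open>W\<close> lie outside \<open>e0\<close>, while
          \<open>?A\<close> has three.\<close>
        have "\<not> ?A \<subseteq> W - e0"
        proof
          assume "?A \<subseteq> W - e0"
          then have "card ?A \<le> card (W - e0)" using W(2) by (intro card_mono) auto
          also have "\<dots> = 2" using e0' W by (simp add: card_Diff_subset)
          finally show False using \<open>card ?A = 3\<close> by simp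
        qed
        then obtain g where "g \<in> e0" "snd g < 3" by auto
        then show ?thesis using one by blast
      qed
      then obtain g where g: "g \<in> e0" "snd g < 3" "card {s \<in> W. snd s = snd g} = 1" by blast
      then obtain g' where g': "{s \<in> W. snd s = snd g} = {g'}" by (metis card_1_singletonE)
      have "g \<in> {s \<in> W. snd s = snd g}" using g(1) e0'(1) by auto
      then have "g = g'" unfolding g' by simp
      then have "\<forall>s\<in>W - {g}. snd s \<noteq> snd g" using g' by blast
      then show ?thesis using g by blast
    qed
    then obtain g i where g: "g \<in> e0" "i < 3" and no: "\<And>s. s \<in> W - {g} \<Longrightarrow> snd s \<noteq> i" by blast
    let ?U = "W - {g}"
    have injU: "inj_on fst ?U" using inj by (rule inj_on_subset) auto
    have "T \<in> edges H" if T: "T \<in> nsets (fst ` ?U) k" for T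
    proof -
      obtain S where S: "S \<subseteq> ?U" "T = fst ` S" using T by (auto simp: nsets_def subset_image_iff)
      have "card S = k"
        using T card_image[OF inj_on_subset[OF injU S(1)]] S(2) by (simp add: nsets_def)
      then have SW: "S \<in> nsets W k" "S \<noteq> e0" using S(1) g(1) W(2) by (auto simp: nsets_def finite_subset)
      have "{s \<in> S. snd s = i} = {}" using no S(1) by blast
      then have "\<not> transversal S" using g(2) unfolding transversal_def by (metis card.empty zero_neq_one)
      then show ?thesis using edge[OF SW] S(2) by simp
    qed
    moreover have "fst ` ?U \<subseteq> verts H" using W(1) by (auto simp: enriched_blowup_def)
    moreover have "card (fst ` ?U) = k + 1"
      using card_image[OF injU] W(3) subsetD[OF e0'(1) g(1)] by simp
    ultimately show False
      using free_complete_hypergraphD[OF H(2), of "fst ` ?U"] W(2) by blast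
  qed
qed (use k in simp)

lemma card_Sigma_le_if_inj:
  assumes "inj_on f (Sigma A B)" "f ` Sigma A B \<subseteq> C" "finite C" "finite A" "\<And>x. x \<in> A \<Longrightarrow> finite (B x)"
  shows "(\<Sum>x\<in>A. card (B x)) \<le> card C"
proof -
  have "(\<Sum>x\<in>A. card (B x)) = card (Sigma A B)" using assms(4,5) by simp
  also have "\<dots> \<le> card C" using assms(1-3) by (rule card_inj_on_le)
  finally show ?thesis .
qed

text \<open>Edges are counted as graphs of layer functions on \<open>k\<close>-sets: edges of
  \<open>H\<close> keep most functions, non-edges gain the transversal ones. If the subtraction
  truncates to 0 the bound is still true.\<close>

lemma card_edges_enriched_blowup:
  assumes H: "uniform_hypergraph k H" and kM: "k \<ge> 3" "M \<ge> 3"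
  shows "card (edges H) * (M ^ k - (k choose 4) * (81 * M ^ (k - 4)))
      + ((card (verts H) choose k) - card (edges H)) * (M - 3) ^ (k - 3)
    \<le> card (edges (enriched_blowup k M H))"
proof -
  let ?V = "verts H" and ?E = "edges H" and ?N = "nsets (verts H) k"
  define B where "B T = {g \<in> T \<rightarrow>\<^sub>E {..<M}.
      (\<forall>i<3. card {x \<in> T. g x = i} = 1) \<or> T \<in> ?E \<and> card {x \<in> T. g x < 3} \<le> 3}" for T
  \<comment> \<open>Extensionality of \<open>g\<close> outside \<open>T\<close> makes the pair
    \<open>(T, g)\<close> recoverable from the graph.\<close>
  define gr :: "'a set \<times> ('a \<Rightarrow> nat) \<Rightarrow> ('a \<times> nat) set"
    where "gr p = (\<lambda>x. (x, snd p x)) ` fst p" for p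
  have finV: "finite ?V" and sub: "?E \<subseteq> ?N" using H by (auto simp: uniform_hypergraph_def)
  have finN: "finite ?N" using finV by (rule finite_imp_finite_nsets)
  have T: "T \<subseteq> ?V" "finite T" "card T = k" if "T \<in> ?N" for T using that by (auto simp: nsets_def)
  have finB: "finite (B T)" if "T \<in> ?N" for T
    unfolding B_def using T(2)[OF that] by (intro finite_subset[OF _ finite_PiE[of T "\<lambda>_. {..<M}"]]) auto
  have fst_gr: "fst ` gr p = fst p" for p unfolding gr_def by (simp add: image_image)
  have mem_gr: "(x, y) \<in> gr p \<longleftrightarrow> x \<in> fst p \<and> y = snd p x" for x y p unfolding gr_def by auto
  have card_gr: "card {s \<in> gr p. P (snd s)} = card {x \<in> fst p. P (snd p x)}" for p P
  proof -
    have "{s \<in> gr p. P (snd s)} = (\<lambda>x. (x, snd p x)) ` {x \<in> fst p. P (snd p x)}"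
      unfolding gr_def by auto
    moreover have "inj_on (\<lambda>x. (x, snd p x)) {x \<in> fst p. P (snd p x)}" by (rule inj_onI) simp
    ultimately show ?thesis by (simp add: card_image)
  qed
  have inj: "inj_on gr (Sigma ?N B)"
  proof (rule inj_onI)
    fix p p' assume p: "p \<in> Sigma ?N B" "p' \<in> Sigma ?N B" "gr p = gr p'"
    have fst: "fst p = fst p'" using p(3) by (metis fst_gr)
    have "snd p \<in> fst p \<rightarrow>\<^sub>E {..<M}" "snd p' \<in> fst p \<rightarrow>\<^sub>E {..<M}"
      using p(1,2) fst unfolding B_def by auto
    moreover have "snd p x = snd p' x" if "x \<in> fst p" for x
      using that p(3) mem_gr[of x "snd p x" p] mem_gr[of x "snd p x" p'] by simp
    ultimately have "snd p = snd p'" by (rule PiE_ext)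
    with fst show "p = p'" by (rule prod_eqI)
  qed
  have edge: "gr p \<in> edges (enriched_blowup k M H)" if p: "p \<in> Sigma ?N B" for p
  proof -
    obtain A g where Ag: "p = (A, g)" "A \<in> ?N" "g \<in> B A" using p by auto
    have "inj_on (\<lambda>x. (x, g x)) A" by (rule inj_onI) simp
    then have "gr p \<in> nsets (?V \<times> {..<M}) k"
      using Ag T[OF Ag(2)] unfolding gr_def nsets_def B_def by (auto simp: card_image PiE_iff)
    moreover have "inj_on fst (gr p)" unfolding gr_def by (auto intro!: inj_onI)
    moreover have "transversal (gr p) \<or> fst ` gr p \<in> ?E \<and> card {s \<in> gr p. snd s < 3} \<le> 3"
      using Ag(3) unfolding transversal_def fst_gr card_gr[of p "\<lambda>y. y = _"] card_gr[of p "\<lambda>y. y < 3"]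
      by (simp add: Ag(1) B_def)
    ultimately show ?thesis by (simp add: enriched_blowup_def)
  qed
  have finG: "finite (edges (enriched_blowup k M H))"
    using uniform_edges_finite[OF uniform_enriched_blowup[OF finV]] .
  have "(\<Sum>T\<in>?N. card (B T)) \<le> card (edges (enriched_blowup k M H))"
    using edge by (intro card_Sigma_le_if_inj[OF inj] finB finN finG) auto
  moreover have "(\<Sum>T\<in>?N. card (B T)) = (\<Sum>T\<in>?E. card (B T)) + (\<Sum>T\<in>?N - ?E. card (B T))"
    using sum.subset_diff[OF sub finN] by (simp only: add.commute)
  moreover have "(\<Sum>T\<in>?E. M ^ k - (k choose 4) * (81 * M ^ (k - 4))) \<le> (\<Sum>T\<in>?E. card (B T))"
  proof (rule sum_mono)
    fix A assume "A \<in> ?E"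
    then have A: "A \<in> ?N" using sub by blast
    have "card {g \<in> A \<rightarrow>\<^sub>E {..<M}. card {x \<in> A. g x < 3} \<le> 3} \<le> card (B A)"
      using finB[OF A] \<open>A \<in> ?E\<close> unfolding B_def by (intro card_mono) auto
    then show "M ^ k - (k choose 4) * (81 * M ^ (k - 4)) \<le> card (B A)"
      using card_maps_few_small_ge[OF T(2,3)[OF A], of M] by linarith
  qed
  moreover have "(\<Sum>T\<in>?N - ?E. (M - 3) ^ (k - 3)) \<le> (\<Sum>T\<in>?N - ?E. card (B T))"
  proof (rule sum_mono)
    fix A assume "A \<in> ?N - ?E"
    then have A: "A \<in> ?N" by blast
    have "card {g \<in> A \<rightarrow>\<^sub>E {..<M}. \<forall>i<3. card {x \<in> A. g x = i} = 1} \<le> card (B A)"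
      using finB[OF A] unfolding B_def by (intro card_mono) auto
    then show "(M - 3) ^ (k - 3) \<le> card (B A)"
      using card_transversal_maps_ge[OF T(2,3)[OF A] kM] by linarith
  qed
  moreover have "card (?N - ?E) = (card ?V choose k) - card ?E"
    using sub finN finV by (simp add: card_Diff_subset finite_subset card_nsets)
  ultimately show ?thesis by simp
qed

section \<open>Density gain from the enriched blow-up\<close>

lemma turan_number_minus_ge:
  assumes "k \<ge> 4" "M \<ge> 3"
  defines "e \<equiv> \<lambda>n. turan_number k n (complete_hypergraph k (k + 1))"
  shows "e n * (M ^ k - (k choose 4) * (81 * M ^ (k - 4))) + ((n choose k) - e n) * (M - 3) ^ (k - 3)
    \<le> turan_number k (M * n) (complete_hypergraph_minus k (k + 2))"
proof -
  obtain H :: "nat hypergraph" where H: "uniform_hypergraph k H" "verts H = {..<n}"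
    "hypergraph_free (complete_hypergraph k (k + 1)) H" "card (edges H) = e n"
    unfolding e_def using turan_number_attained[OF complete_hypergraph_edges_nonempty] .
  let ?G = "enriched_blowup k M H"
  have "card (edges ?G) \<le> turan_number k (card (verts ?G)) (complete_hypergraph_minus k (k + 2))"
    using H(2) by (intro card_edges_le_turan_number uniform_enriched_blowup
        enriched_blowup_free H(1,3) assms(1)) simp
  moreover have "card (verts ?G) = M * n"
    using H(2) by (simp add: enriched_blowup_def card_cartesian_product mult.commute)
  ultimately show ?thesis
    using card_edges_enriched_blowup[OF H(1), of M] assms(1,2) H(2,4) by simp
qed

lemma turan_density_complete_less_minus:
  assumes k: "k \<ge> 4"
  shows "turan_density k (complete_hypergraph k (k + 1)) < turan_density k (complete_hypergraph_minus k (k + 2))"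
proof -
  let ?F = "complete_hypergraph k (k + 1)" and ?F' = "complete_hypergraph_minus k (k + 2)"
  define p where "p = turan_density k ?F"
  define e where "e n = turan_number k n ?F" for n
  have ne: "edges ?F \<noteq> {}" by (rule complete_hypergraph_edges_nonempty)
  have ne': "edges ?F' \<noteq> {}" using k by (intro complete_hypergraph_minus_edges_nonempty) simp
  have p: "0 \<le> p" "p < 1"
    unfolding p_def using turan_density_nonneg[OF ne] turan_density_complete_lt_1 k by auto
  define C :: real where "C = 81 * real (k choose 4)"
  \<comment> \<open>The gain grows like \<open>M ^ (k - 3)\<close>, the loss like
    \<open>C * M ^ (k - 4)\<close>. The factor \<open>2 ^ (k - 3)\<close> pays for replacing
    \<open>M - 3\<close> by half of \<open>M\<close>, which \<open>M \<ge> 6\<close> allows.\<close>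
  obtain M0 :: nat where M0: "C * 2 ^ (k - 3) / (1 - p) < real M0" using reals_Archimedean2 by blast
  define M where "M = max M0 6"
  have M: "M \<ge> 6" "C * 2 ^ (k - 3) / (1 - p) < real M" using M0 unfolding M_def by auto
  define P where "P = M ^ k - (k choose 4) * (81 * M ^ (k - 4))"
  define t where "t = (M - 3) ^ (k - 3)"
  have P: "real P \<ge> real M ^ k - C * real M ^ (k - 4)"
  proof -
    have "M ^ k \<le> P + (k choose 4) * (81 * M ^ (k - 4))" unfolding P_def by simp
    then have "real (M ^ k) \<le> real (P + (k choose 4) * (81 * M ^ (k - 4)))" by (simp only: of_nat_le_iff)
    then show ?thesis unfolding C_def by simp
  qed
  have t: "real t * 2 ^ (k - 3) \<ge> real M * real M ^ (k - 4)"
  proof -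
    have "M ^ (k - 3) \<le> ((M - 3) * 2) ^ (k - 3)" using M(1) by (intro power_mono) auto
    then have "real (M ^ (k - 3)) \<le> real (((M - 3) * 2) ^ (k - 3))" by (simp only: of_nat_le_iff)
    moreover have "k - 3 = Suc (k - 4)" using k by simp
    ultimately show ?thesis unfolding t_def by (simp add: power_mult_distrib)
  qed
  have gain: "p * (C * real M ^ (k - 4)) < (1 - p) * real t"
  proof -
    have "C * 2 ^ (k - 3) < (1 - p) * real M" using M(2) p by (simp add: field_simps)
    then have "C * 2 ^ (k - 3) * real M ^ (k - 4) < (1 - p) * real M * real M ^ (k - 4)"
      using M(1) by (intro mult_strict_right_mono) auto
    also have "\<dots> \<le> (1 - p) * (real t * 2 ^ (k - 3))"
      unfolding mult.assoc using t p by (intro mult_left_mono) auto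
    finally have "2 ^ (k - 3) * (C * real M ^ (k - 4)) < 2 ^ (k - 3) * ((1 - p) * real t)"
      by (simp add: algebra_simps)
    then have "C * real M ^ (k - 4) < (1 - p) * real t" by (rule mult_less_cancel_left_pos[THEN iffD1, rotated]) simp
    moreover have "p * (C * real M ^ (k - 4)) \<le> 1 * (C * real M ^ (k - 4))"
      using p unfolding C_def by (intro mult_right_mono) auto
    ultimately show ?thesis by simp
  qed
  \<comment> \<open>Ensures that the natural subtraction \<open>(n choose k) - e n\<close> agrees
    with the real one.\<close>
  have e_le: "e n \<le> n choose k" for n
  proof -
    obtain H :: "nat hypergraph" where "uniform_hypergraph k H" "verts H = {..<n}"
      "hypergraph_free ?F H" "card (edges H) = e n"
      unfolding e_def using turan_number_attained[OF ne] .
    then show ?thesis using uniform_card_edges_le[of k H] by simp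
  qed
  let ?g = "\<lambda>n. real (e n) * real P + (real (n choose k) - real (e n)) * real t"
  have "(\<lambda>n. real (turan_number k (1 * n) ?F) / real n ^ k) \<longlonglongrightarrow> p * (real 1 ^ k / fact k)"
    unfolding p_def by (rule turan_number_over_power_tendsto[OF ne]) simp
  then have "(\<lambda>n. real (e n) / real n ^ k) \<longlonglongrightarrow> p * (1 / fact k)" by (simp add: e_def)
  then have "(\<lambda>n. real (e n) / real n ^ k * real P
        + (real (n choose k) / real n ^ k - real (e n) / real n ^ k) * real t)
      \<longlonglongrightarrow> p * (1 / fact k) * real P + (1 / fact k - p * (1 / fact k)) * real t"
    by (intro tendsto_intros binomial_over_power_tendsto)
  then have lim: "(\<lambda>n. ?g n / real n ^ k)
      \<longlonglongrightarrow> p * (1 / fact k) * real P + (1 / fact k - p * (1 / fact k)) * real t"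
    by (simp add: add_divide_distrib diff_divide_distrib left_diff_distrib)
  have "(p * (1 / fact k) * real P + (1 / fact k - p * (1 / fact k)) * real t) * fact k / real M ^ k
      \<le> turan_density k ?F'"
  proof (rule turan_density_geI[OF ne' _ lim])
    fix n
    have "e n * P + ((n choose k) - e n) * t \<le> turan_number k (M * n) ?F'"
      unfolding e_def P_def t_def using k M(1) by (intro turan_number_minus_ge) auto
    then have "real (e n * P + ((n choose k) - e n) * t) \<le> real (turan_number k (M * n) ?F')"
      by (simp only: of_nat_le_iff)
    then show "?g n \<le> real (turan_number k (M * n) ?F')" using e_le[of n] by (simp add: of_nat_diff)
  qed (use M(1) in simp)
  moreover have "(p * (1 / fact k) * real P + (1 / fact k - p * (1 / fact k)) * real t) * fact k
      = p * real P + (1 - p) * real t"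
    by (simp add: field_simps)
  ultimately have ge: "(p * real P + (1 - p) * real t) / real M ^ k \<le> turan_density k ?F'" by simp
  \<comment> \<open>The loss weighted by \<open>p\<close> is outweighed by the gain weighted by
    \<open>1 - p\<close>, so the new density exceeds \<open>p\<close>.\<close>
  have "p * (real M ^ k - C * real M ^ (k - 4)) \<le> p * real P" using P p(1) by (rule mult_left_mono)
  then have "p * real M ^ k < p * real P + (1 - p) * real t"
    using gain by (simp add: right_diff_distrib)
  then have "p < (p * real P + (1 - p) * real t) / real M ^ k" using M(1) by (simp add: field_simps)
  with ge show ?thesis unfolding p_def by linarith
qed

theorem theorem1p3:
  fixes k :: nat
  assumes "k \<ge> 3"
  shows "turan_density k (complete_hypergraph k (k + 1))
           < turan_density k (complete_hypergraph_minus k (k + 2))"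
proof (cases "k = 3")
  case True
  then show ?thesis using turan_density_K4_less_K5_minus by simp
next
  case False
  with assms show ?thesis by (intro turan_density_complete_less_minus) simp
qed

end
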